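(* Let $(\dot{\mathcal B},\widehat{\mathcal B},\mathcal B)$ be the model triple in the Hilbert space $L^2(\mathbb R;d\mu)$ with parameter $\kappa$, $|\kappa|<1$. Then the resolvent of the model dissipative operator $\widehat{\mathcal B}$ has the form $$(\widehat{\mathcal B}-zI)^{-1}=(\mathcal B-zI)^{-1}-p(z)\,(\cdot\,,g_{\overline z})\,g_z,\qquad z\in\rho(\widehat{\mathcal B})\cap\rho(\mathcal B),$$ with $$p(z)=\left(M(\dot{\mathcal B},\mathcal B)(z)+i\,\frac{\kappa+1}{\kappa-1}\right)^{-1},$$ where $M(\dot{\mathcal B},\mathcal B)$ is the Weyl–Titchmarsh function of the pair $(\dot{\mathcal B},\mathcal B)$, continued to the lower half-plane by the Schwarz reflection principle, and the deficiency elements $g_z$ are given by $g_z(\lambda)=\frac{1}{\lambda-z}$ for $\mu$-a.e. $\lambda$.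
   Context: $\mathbb C_+$ is the open upper half-plane, $\mathbb D$ the open unit disk, $\rho(\cdot)$ the resolvent set; inner products are linear in the first argument. Model triple: let $|\kappa|<1$ and let $s:\mathbb C_+\to\mathbb D$ be analytic with $s(i)=0$ and $\lim_{z\to\infty}z(s(z)-e^{2i\alpha})=\infty$ for all $\alpha\in[0,\pi)$, the limit being taken in every sector $0<\varepsilon\le\arg z\le\pi-\varepsilon$. Put $S(z)=\frac{s(z)-\kappa}{\overline\kappa s(z)-1}$ (so $S(i)=\kappa$) and $M(z)=\frac1i\cdot\frac{s(z)+1}{s(z)-1}$, $z\in\mathbb C_+$. Then $M(z)=\int_{\mathbb R}\left(\frac1{\lambda-z}-\frac{\lambda}{1+\lambda^2}\right)d\mu(\lambda)$ for an infinite Borel measure $\mu$ with $\int_{\mathbb R}\frac{d\mu(\lambda)}{1+\lambda^2}=1$. In $L^2(\mathbb R;d\mu)$: $\mathcal B$ is multiplication by the independent variable on $\operatorname{Dom}(\mathcal B)=\{f:\int\lambda^2|f|^2d\mu<\infty\}$; $\dot{\mathcal B}$ is its restriction to $\{f\in\operatorname{Dom}(\mathcal B):\int f\,d\mu=0\}$; $\widehat{\mathcal B}$ is the restriction of $(\dot{\mathcal B})^*$ to $\operatorname{Dom}(\dot{\mathcal B})\dot+\operatorname{span}\left\{\frac1{\cdot-i}-\kappa\frac1{\cdot+i}\right\}$. Weyl–Titchmarsh function: $M(\dot{\mathcal B},\mathcal B)(z)=((\mathcal Bz+I)(\mathcal B-zI)^{-1}g_+,g_+)$, $z\in\mathbb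 C_+$, with $g_+\in\operatorname{Ker}((\dot{\mathcal B})^*-iI)$, $\|g_+\|=1$; it is extended by $M(z)=\overline{M(\overline z)}$ to the lower half-plane and analytically to real points of $\rho(\mathcal B)$. *)

theory Defs
  imports "HOL-Analysis.Analysis"
begin

text \<open>
  The Hilbert space \<open>L\<^sup>2(\<mu>)\<close> is represented by its square-integrable functions; equality of
  vectors is equality \<open>\<mu>\<close>-almost everywhere.  An operator is its graph, a set of pairs of
  square-integrable functions that is closed under changing either component on a \<open>\<mu>\<close>-null set.
\<close>

type_synonym l2_operator = "((real \<Rightarrow> complex) \<times> (real \<Rightarrow> complex)) set"

definition L2 :: "real measure \<Rightarrow> (real \<Rightarrow> complex) set" where
  "L2 \<mu> = {f \<in> borel_measurable \<mu>. integrable \<mu> (\<lambda>x. (cmod (f x))\<^sup>2)}"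

definition l2_inner :: "real measure \<Rightarrow> (real \<Rightarrow> complex) \<Rightarrow> (real \<Rightarrow> complex) \<Rightarrow> complex" where
  "l2_inner \<mu> f g = (LINT x|\<mu>. f x * cnj (g x))"

definition l2_norm :: "real measure \<Rightarrow> (real \<Rightarrow> complex) \<Rightarrow> real" where
  "l2_norm \<mu> f = sqrt (LINT x|\<mu>. (cmod (f x))\<^sup>2)"

text \<open>The operator \<open>a A + b I\<close>.\<close>

definition op_affine :: "real measure \<Rightarrow> complex \<Rightarrow> complex \<Rightarrow> l2_operator \<Rightarrow> l2_operator" where
  "op_affine \<mu> a b A =
     {(f, k). k \<in> L2 \<mu> \<and> (\<exists>h. (f, h) \<in> A \<and> (AE x in \<mu>. k x = a * h x + b * f x))}"

definition op_adjoint :: "real measure \<Rightarrow> l2_operator \<Rightarrow> l2_operator" where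
  "op_adjoint \<mu> A =
     {(f, g). f \<in> L2 \<mu> \<and> g \<in> L2 \<mu> \<and> (\<forall>(u, v) \<in> A. l2_inner \<mu> v f = l2_inner \<mu> u g)}"

text \<open>The graph of \<open>(A - zI)\<^sup>-\<^sup>1\<close>; for \<open>z\<close> outside the resolvent set it is merely a relation.\<close>

definition resolvent :: "real measure \<Rightarrow> l2_operator \<Rightarrow> complex \<Rightarrow> l2_operator" where
  "resolvent \<mu> A z = (op_affine \<mu> 1 (- z) A)\<inverse>"

definition resolvent_set :: "real measure \<Rightarrow> l2_operator \<Rightarrow> complex set" where
  "resolvent_set \<mu> A =
     {z. (\<forall>h \<in> L2 \<mu>. \<exists>f. (h, f) \<in> resolvent \<mu> A z) \<and>
         (\<forall>h f f'. (h, f) \<in> resolvent \<mu> A z \<longrightarrow> (h, f') \<in> resolvent \<mu> A z \<longrightarrow>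
            (AE x in \<mu>. f x = f' x)) \<and>
         (\<exists>C. \<forall>(h, f) \<in> resolvent \<mu> A z. l2_norm \<mu> f \<le> C * l2_norm \<mu> h)}"

text \<open>\<open>Ker (A\<^sup>* - zI)\<close>\<close>

definition deficiency_space :: "real measure \<Rightarrow> l2_operator \<Rightarrow> complex \<Rightarrow> (real \<Rightarrow> complex) set" where
  "deficiency_space \<mu> A z = {g. (g, \<lambda>x. z * g x) \<in> op_adjoint \<mu> A}"

text \<open>
  The form \<open>((Az + I)(A - zI)\<^sup>-\<^sup>1 g, g)\<close>.  Relational composition applies its left argument first;
  the vector chosen by \<open>SOME\<close> is determined up to a null set when \<open>z\<close> is in the resolvent set.
\<close>

definition weyl_form :: "real measure \<Rightarrow> l2_operator \<Rightarrow> (real \<Rightarrow> complex) \<Rightarrow> complex \<Rightarrow> complex" where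
  "weyl_form \<mu> A g z =
     l2_inner \<mu> (SOME k. (g, k) \<in> resolvent \<mu> A z O op_affine \<mu> z 1 A) g"

definition weyl_nonreal :: "real measure \<Rightarrow> l2_operator \<Rightarrow> (real \<Rightarrow> complex) \<Rightarrow> complex \<Rightarrow> complex" where
  "weyl_nonreal \<mu> A g z =
     (if Im z > 0 then weyl_form \<mu> A g z else cnj (weyl_form \<mu> A g (cnj z)))"

text \<open>
  The Weyl-Titchmarsh function of \<open>(A0, A)\<close>, where \<open>g\<close> is a unit vector of \<open>Ker (A0\<^sup>* - iI)\<close>.
  The value at a real point is that of the holomorphic continuation across this point; it is
  meaningful only where such a continuation exists, in particular at real points of the
  resolvent set of \<open>A\<close>.
\<close>

definition weyl_titchmarsh :: "real measure \<Rightarrow> l2_operator \<Rightarrow> (real \<Rightarrow> complex) \<Rightarrow> complex \<Rightarrow> complex" where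
  "weyl_titchmarsh \<mu> A g z =
     (if Im z \<noteq> 0 then weyl_nonreal \<mu> A g z
      else (THE w. \<exists>r > 0. \<exists>F. F holomorphic_on ball z r \<and>
              (\<forall>\<zeta> \<in> ball z r. Im \<zeta> \<noteq> 0 \<longrightarrow> F \<zeta> = weyl_nonreal \<mu> A g \<zeta>) \<and> F z = w))"

definition livsic_to_weyl :: "(complex \<Rightarrow> complex) \<Rightarrow> complex \<Rightarrow> complex" where
  "livsic_to_weyl s z = (1 / \<i>) * ((s z + 1) / (s z - 1))"

text \<open>The operators of the model triple: self-adjoint, symmetric and dissipative.\<close>

definition mult_op :: "real measure \<Rightarrow> l2_operator" where
  "mult_op \<mu> =
     {(f, k). f \<in> L2 \<mu> \<and> integrable \<mu> (\<lambda>x. x\<^sup>2 * (cmod (f x))\<^sup>2) \<and>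
              k \<in> L2 \<mu> \<and> (AE x in \<mu>. k x = complex_of_real x * f x)}"

definition sym_op :: "real measure \<Rightarrow> l2_operator" where
  "sym_op \<mu> = {(f, k) \<in> mult_op \<mu>. (LINT x|\<mu>. f x) = 0}"

definition defic_elem :: "complex \<Rightarrow> real \<Rightarrow> complex" where
  "defic_elem z x = 1 / (complex_of_real x - z)"

definition dissip_op :: "real measure \<Rightarrow> complex \<Rightarrow> l2_operator" where
  "dissip_op \<mu> \<kappa> =
     {(f, k) \<in> op_adjoint \<mu> (sym_op \<mu>).
        \<exists>u \<in> Domain (sym_op \<mu>). \<exists>c.
          AE x in \<mu>. f x = u x + c * (defic_elem \<i> x - \<kappa> * defic_elem (- \<i>) x)}"

end

theory Submission
  imports Defs
begin

text \<open>
  In \<open>L\<^sup>2(\<mu>)\<close> every operator of the triple acts as multiplication by \<open>x\<close> up to a constant, so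
  that the resolvent equation of the dissipative operator becomes a scalar equation.

  The functions \<open>u\<close> in the domain of the symmetric operator are exactly \<open>w / (x + \<i>)\<close> with
  \<open>w \<in> L\<^sup>2(\<mu>)\<close> orthogonal to \<open>1 / (x - \<i>)\<close>, because \<open>\<integral> u d\<mu>\<close> is the inner product of \<open>w\<close> with
  that function.  Testing the adjoint relation against these \<open>w\<close> shows that the graph of the
  adjoint consists of all pairs \<open>(f, x f + c)\<close> of square-integrable functions with a constant
  \<open>c\<close> (\<open>adjoint_sym_op_iff\<close>).  Since the measure is infinite, \<open>1 \<notin> L\<^sup>2(\<mu>)\<close>, and therefore the
  coefficient of the deficiency vector \<open>1 / (x - \<i>) - \<kappa> / (x + \<i>)\<close> in an element of the domain of
  the dissipative operator is determined by \<open>c\<close>; its domain is then described by the boundary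
  condition \<open>\<integral> (f - a b\<^sub>\<kappa>) d\<mu> = 0\<close>, where \<open>a = - c\<close> and \<open>b\<^sub>\<kappa>\<close> is that vector divided by \<open>1 - \<kappa>\<close>
  (\<open>dissip_op_iff\<close>).

  Solving \<open>x f - a - z f = h\<close> gives \<open>f = h / (x - z) + a / (x - z)\<close>, and the boundary condition reads
  \<open>\<integral> h / (x - z) d\<mu> + a \<integral> (1 / (x - z) - b\<^sub>\<kappa>) d\<mu> = 0\<close>.  The first integral is
  \<open>(h, g\<^sub>w)\<close> with \<open>w\<close> the conjugate of \<open>z\<close>.  As
  \<open>b\<^sub>\<kappa> = x / (1 + x\<^sup>2) + \<i> ((1 + \<kappa>) / (1 - \<kappa>)) / (1 + x\<^sup>2)\<close> and \<open>\<integral> d\<mu> / (1 + x\<^sup>2) = 1\<close>,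
  the second one is \<open>D = N(z) + \<i> (\<kappa> + 1) / (\<kappa> - 1)\<close>, where
  \<open>N(z) = \<integral> (1 / (x - z) - x / (1 + x\<^sup>2)) d\<mu>\<close> (\<open>dissip_op_resolvent_iff\<close>).  If \<open>D\<close> vanished,
  \<open>g\<^sub>z\<close> would be an eigenvector of the dissipative operator for the eigenvalue \<open>z\<close>, which is
  excluded by \<open>z\<close> being in its resolvent set; hence \<open>a = - (h, g\<^sub>w) / D\<close>, which is the asserted formula.

  It remains to identify \<open>N\<close> with the Weyl-Titchmarsh function.  A unit deficiency vector at \<open>\<i>\<close> is
  a unimodular multiple of \<open>1 / (x - \<i>)\<close>, which makes the Weyl form at a nonreal point the integral of
  \<open>(1 + z x) / ((x - z) (1 + x\<^sup>2))\<close>, that is, \<open>N(z)\<close>.  At a real point of the resolvent set of the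
  multiplication operator the measure vanishes near \<open>z\<close>, so that \<open>N\<close> is holomorphic across
  \<open>z\<close> and supplies the continuation (\<open>weyl_titchmarsh_eq_nevanlinna\<close>).
\<close>

section \<open>Square-integrable functions\<close>

locale poisson_measure =
  fixes \<mu> :: "real measure"
  assumes sets_eq: "sets \<mu> = sets borel"
    and poisson_integrable: "integrable \<mu> (\<lambda>x. 1 / (1 + x\<^sup>2))"
begin

lemma measurable_eq: "borel_measurable \<mu> = borel_measurable borel"
  by (rule measurable_cong_sets[OF sets_eq refl])

lemma borel_measurable_mu [measurable (raw)]:
  "f \<in> borel_measurable borel \<Longrightarrow> f \<in> borel_measurable \<mu>"
  by (simp add: measurable_eq)

lemma cnj_measurable [measurable]: "cnj \<in> borel_measurable borel"
  by (rule borel_measurable_continuous_onI[OF continuous_on_cnj[OF continuous_on_id]])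

lemma defic_elem_measurable [measurable]: "defic_elem z \<in> borel_measurable borel"
  unfolding defic_elem_def by measurable

lemma L2_bounded_mult:
  assumes f: "f \<in> L2 \<mu>" and m: "\<phi> \<in> borel_measurable \<mu>"
    and b: "AE x in \<mu>. cmod (\<phi> x) \<le> C"
  shows "(\<lambda>x. \<phi> x * f x) \<in> L2 \<mu>"
proof -
  have fm [measurable]: "f \<in> borel_measurable \<mu>" using f by (simp add: L2_def)
  note m [measurable]
  have "integrable \<mu> (\<lambda>x. C\<^sup>2 * (cmod (f x))\<^sup>2)" using f by (simp add: L2_def)
  then have "integrable \<mu> (\<lambda>x. (cmod (\<phi> x * f x))\<^sup>2)"
  proof (rule Bochner_Integration.integrable_bound)
    show "AE x in \<mu>. norm ((cmod (\<phi> x * f x))\<^sup>2) \<le> norm (C\<^sup>2 * (cmod (f x))\<^sup>2)"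
      using b
    proof eventually_elim
      case (elim x)
      then have "(cmod (\<phi> x))\<^sup>2 \<le> C\<^sup>2" by (intro power_mono) auto
      then show ?case
        by (simp add: norm_mult power_mult_distrib mult_right_mono)
    qed
  qed measurable
  then show ?thesis by (simp add: L2_def)
qed

lemma L2_scale: "f \<in> L2 \<mu> \<Longrightarrow> (\<lambda>x. c * f x) \<in> L2 \<mu>"
  by (rule L2_bounded_mult[where C = "cmod c"]) auto

lemma L2_add:
  assumes f: "f \<in> L2 \<mu>" and g: "g \<in> L2 \<mu>"
  shows "(\<lambda>x. f x + g x) \<in> L2 \<mu>"
proof -
  have fm [measurable]: "f \<in> borel_measurable \<mu>" "g \<in> borel_measurable \<mu>"
    using f g by (simp_all add: L2_def)
  have "integrable \<mu> (\<lambda>x. 2 * (cmod (f x))\<^sup>2 + 2 * (cmod (g x))\<^sup>2)"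
    using f g by (simp add: L2_def)
  then have "integrable \<mu> (\<lambda>x. (cmod (f x + g x))\<^sup>2)"
  proof (rule Bochner_Integration.integrable_bound)
    show "AE x in \<mu>. norm ((cmod (f x + g x))\<^sup>2) \<le> norm (2 * (cmod (f x))\<^sup>2 + 2 * (cmod (g x))\<^sup>2)"
    proof (rule AE_I2)
      fix x
      have "(cmod (f x + g x))\<^sup>2 \<le> (cmod (f x) + cmod (g x))\<^sup>2"
        by (intro power_mono norm_triangle_ineq) auto
      also have "\<dots> \<le> 2 * (cmod (f x))\<^sup>2 + 2 * (cmod (g x))\<^sup>2"
        using sum_squares_bound[of "cmod (f x)" "cmod (g x)"] by (simp add: power2_sum)
      finally show "norm ((cmod (f x + g x))\<^sup>2) \<le> norm (2 * (cmod (f x))\<^sup>2 + 2 * (cmod (g x))\<^sup>2)"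
        by simp
    qed
  qed measurable
  then show ?thesis by (simp add: L2_def)
qed

lemma L2_diff: "f \<in> L2 \<mu> \<Longrightarrow> g \<in> L2 \<mu> \<Longrightarrow> (\<lambda>x. f x - g x) \<in> L2 \<mu>"
  using L2_add[of f "\<lambda>x. - 1 * g x"] L2_scale[of g "- 1"] by simp

lemma L2_cong_AE:
  assumes "f \<in> L2 \<mu>" and m [measurable]: "g \<in> borel_measurable \<mu>" and ae: "AE x in \<mu>. f x = g x"
  shows "g \<in> L2 \<mu>"
proof -
  have [measurable]: "f \<in> borel_measurable \<mu>" and i: "integrable \<mu> (\<lambda>x. (cmod (f x))\<^sup>2)"
    using assms(1) by (simp_all add: L2_def)
  have "integrable \<mu> (\<lambda>x. (cmod (g x))\<^sup>2)"
    by (rule integrable_cong_AE_imp[OF i]) (use ae in auto)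
  then show ?thesis by (simp add: L2_def)
qed

lemma L2_mult_integrable:
  assumes f: "f \<in> L2 \<mu>" and g: "g \<in> L2 \<mu>"
  shows "integrable \<mu> (\<lambda>x. f x * g x)"
proof -
  have fm [measurable]: "f \<in> borel_measurable \<mu>" "g \<in> borel_measurable \<mu>"
    using f g by (simp_all add: L2_def)
  have "integrable \<mu> (\<lambda>x. (cmod (f x))\<^sup>2 + (cmod (g x))\<^sup>2)"
    using f g by (simp add: L2_def)
  then show ?thesis
  proof (rule Bochner_Integration.integrable_bound)
    show "AE x in \<mu>. norm (f x * g x) \<le> norm ((cmod (f x))\<^sup>2 + (cmod (g x))\<^sup>2)"
    proof (rule AE_I2)
      fix x
      have "0 \<le> cmod (f x) * cmod (g x)" by simp
      then have "cmod (f x) * cmod (g x) \<le> (cmod (f x))\<^sup>2 + (cmod (g x))\<^sup>2"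
        using sum_squares_bound[of "cmod (f x)" "cmod (g x)"] by linarith
      then show "norm (f x * g x) \<le> norm ((cmod (f x))\<^sup>2 + (cmod (g x))\<^sup>2)"
        by (simp add: norm_mult)
    qed
  qed measurable
qed

lemma L2_cnj: "f \<in> L2 \<mu> \<Longrightarrow> (\<lambda>x. cnj (f x)) \<in> L2 \<mu>"
  using measurable_compose[OF _ cnj_measurable] by (auto simp: L2_def)

lemma L2_inner_integrable:
  "f \<in> L2 \<mu> \<Longrightarrow> g \<in> L2 \<mu> \<Longrightarrow> integrable \<mu> (\<lambda>x. f x * cnj (g x))"
  using L2_mult_integrable L2_cnj by blast

lemma L2_inner_self_zero:
  assumes f: "f \<in> L2 \<mu>" and z: "l2_inner \<mu> f f = 0"
  shows "AE x in \<mu>. f x = 0"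
proof -
  have i: "integrable \<mu> (\<lambda>x. (cmod (f x))\<^sup>2)" using f by (simp add: L2_def)
  have "l2_inner \<mu> f f = (LINT x|\<mu>. complex_of_real ((cmod (f x))\<^sup>2))"
    unfolding l2_inner_def by (simp only: complex_norm_square)
  also have "\<dots> = complex_of_real (LINT x|\<mu>. (cmod (f x))\<^sup>2)"
    by (rule integral_complex_of_real)
  finally have "(LINT x|\<mu>. (cmod (f x))\<^sup>2) = 0" using z by simp
  then have "AE x in \<mu>. (cmod (f x))\<^sup>2 = 0"
    using integral_nonneg_eq_0_iff_AE[OF i] by simp
  then show ?thesis by simp
qed

text \<open>
  The orthogonal complement of the orthogonal complement of a line is the line itself: the component of \<open>q\<close> orthogonal to \<open>e\<close> is one of the test vectors, hence orthogonal
  to \<open>q\<close> and to \<open>e\<close>, and so to itself.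
\<close>

lemma proportional_if_annihilated:
  assumes e: "e \<in> L2 \<mu>" and q: "q \<in> L2 \<mu>" and e1: "l2_inner \<mu> e e = 1"
    and ann: "\<And>w. w \<in> L2 \<mu> \<Longrightarrow> l2_inner \<mu> w e = 0 \<Longrightarrow> l2_inner \<mu> w q = 0"
  shows "\<exists>c. AE x in \<mu>. q x = c * e x"
proof -
  define c where "c = l2_inner \<mu> q e"
  define w where "w = (\<lambda>x. q x - c * e x)"
  have w: "w \<in> L2 \<mu>" unfolding w_def by (intro L2_diff L2_scale e q)
  have "l2_inner \<mu> w e = (LINT x|\<mu>. q x * cnj (e x) - c * (e x * cnj (e x)))"
    unfolding l2_inner_def w_def by (simp add: algebra_simps)
  also have "\<dots> = l2_inner \<mu> q e - c * l2_inner \<mu> e e"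
    unfolding l2_inner_def
    by (subst Bochner_Integration.integral_diff)
      (auto intro!: L2_inner_integrable e q)
  finally have we: "l2_inner \<mu> w e = 0" by (simp add: e1 c_def)
  have "l2_inner \<mu> w w = (LINT x|\<mu>. w x * cnj (q x) - cnj c * (w x * cnj (e x)))"
    unfolding l2_inner_def w_def by (simp add: algebra_simps)
  also have "\<dots> = l2_inner \<mu> w q - cnj c * l2_inner \<mu> w e"
    unfolding l2_inner_def
    by (subst Bochner_Integration.integral_diff)
      (auto intro!: L2_inner_integrable e q w)
  finally have "l2_inner \<mu> w w = 0" using ann[OF w we] we by simp
  from L2_inner_self_zero[OF w this] show ?thesis
    by (intro exI[of _ c]) (simp add: w_def)
qed

section \<open>Spectral gaps and deficiency elements\<close>

text \<open>
  For multiplication by \<open>x\<close> this is the resolvent set; in this form it gives the pointwise bounds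
  on \<open>1 / (x - z)\<close> that the integrals below require.
\<close>

definition gap :: "complex \<Rightarrow> bool" where
  "gap z \<longleftrightarrow> (\<exists>\<delta>>0. AE x in \<mu>. \<delta> \<le> cmod (complex_of_real x - z))"

lemma gap_nonreal: "Im z \<noteq> 0 \<Longrightarrow> gap z"
  unfolding gap_def
  by (rule exI[of _ "\<bar>Im z\<bar>"]) (use abs_Im_le_cmod[of "complex_of_real _ - z"] in auto)

lemma gap_neq: "gap z \<Longrightarrow> AE x in \<mu>. complex_of_real x - z \<noteq> 0"
  unfolding gap_def by (elim exE conjE, erule eventually_mono) auto

lemma gap_radius_halved:
  assumes "AE x in \<mu>. \<delta> \<le> cmod (complex_of_real x - z)" and w: "cmod (w - z) < \<delta> / 2"
  shows "AE x in \<mu>. \<delta> / 2 \<le> cmod (complex_of_real x - w)"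
  using assms(1)
proof eventually_elim
  case (elim x)
  have "cmod (complex_of_real x - z) \<le> cmod (complex_of_real x - w) + cmod (w - z)"
    using norm_triangle_ineq[of "complex_of_real x - w" "w - z"] by simp
  then show ?case using elim w by linarith
qed

lemma gap_open: "gap z \<Longrightarrow> \<exists>r>0. \<forall>w\<in>ball z r. gap w"
proof -
  assume "gap z"
  then obtain \<delta> where d: "\<delta> > 0" and ae: "AE x in \<mu>. \<delta> \<le> cmod (complex_of_real x - z)"
    unfolding gap_def by auto
  have "gap w" if "w \<in> ball z (\<delta> / 2)" for w
  proof -
    have "cmod (w - z) < \<delta> / 2" using that by (simp add: dist_norm norm_minus_commute)
    then show ?thesis using gap_radius_halved[OF ae] unfolding gap_def using d by (intro exI[of _ "\<delta> / 2"]) auto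
  qed
  then show ?thesis using d by (intro exI[of _ "\<delta> / 2"]) auto
qed

lemma gap_cnj: "gap z \<Longrightarrow> gap (cnj z)"
proof -
  have "cmod (complex_of_real x - cnj z) = cmod (complex_of_real x - z)" for x
    using complex_mod_cnj[of "complex_of_real x - z"] by simp
  then show "gap z \<Longrightarrow> gap (cnj z)" unfolding gap_def by simp
qed

lemma defic_elem_cnj: "cnj (defic_elem z x) = defic_elem (cnj z) x"
  by (simp add: defic_elem_def)

lemma of_real_plus_i_neq: "complex_of_real x + \<i> \<noteq> 0" "complex_of_real x - \<i> \<noteq> 0"
  by (auto simp: complex_eq_iff)

lemma defic_elem_ii_norm: "(cmod (defic_elem \<i> x))\<^sup>2 = 1 / (1 + x\<^sup>2)"
  "(cmod (defic_elem (- \<i>) x))\<^sup>2 = 1 / (1 + x\<^sup>2)"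
  by (simp_all add: defic_elem_def norm_divide power_divide cmod_power2 add.commute)

lemma defic_elem_bounded:
  assumes "gap z"
  obtains C where "AE x in \<mu>. cmod (defic_elem z x) \<le> C"
proof -
  obtain \<delta> where d: "\<delta> > 0" "AE x in \<mu>. \<delta> \<le> cmod (complex_of_real x - z)"
    using assms unfolding gap_def by auto
  have "AE x in \<mu>. cmod (defic_elem z x) \<le> 1 / \<delta>"
    using d(2)
    by eventually_elim (use d(1) in \<open>simp add: defic_elem_def norm_divide frac_le\<close>)
  then show ?thesis using that by blast
qed

lemma L2_mult_defic_elem:
  assumes "gap z" "h \<in> L2 \<mu>"
  shows "(\<lambda>x. defic_elem z x * h x) \<in> L2 \<mu>"
proof -
  obtain C where "AE x in \<mu>. cmod (defic_elem z x) \<le> C" using defic_elem_bounded[OF assms(1)] .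
  then show ?thesis by (intro L2_bounded_mult[where C = C] assms) auto
qed

lemma defic_elem_minus_ii_L2: "defic_elem (- \<i>) \<in> L2 \<mu>"
  using poisson_integrable by (simp add: L2_def defic_elem_ii_norm)

lemma defic_elem_resolvent_identity:
  assumes "complex_of_real x - z \<noteq> 0"
  shows "(z + \<i>) * (defic_elem z x * defic_elem (- \<i>) x) = defic_elem z x - defic_elem (- \<i>) x"
proof -
  have "(a - b) * (1 / b * (1 / a)) = 1 / b - 1 / a" if "a \<noteq> 0" "b \<noteq> 0" for a b :: complex
    using that by (simp add: field_simps)
  from this[OF of_real_plus_i_neq(1)[of x] assms]
  show ?thesis by (simp add: defic_elem_def add.commute)
qed

lemma defic_elem_ii_eq:
  "defic_elem \<i> x = complex_of_real (x / (1 + x\<^sup>2)) + \<i> * complex_of_real (1 / (1 + x\<^sup>2))"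
  "defic_elem (- \<i>) x = complex_of_real (x / (1 + x\<^sup>2)) - \<i> * complex_of_real (1 / (1 + x\<^sup>2))"
proof -
  have p: "1 + (complex_of_real x)\<^sup>2 = (complex_of_real x + \<i>) * (complex_of_real x - \<i>)"
    by (simp add: algebra_simps power2_eq_square)
  show "defic_elem \<i> x = complex_of_real (x / (1 + x\<^sup>2)) + \<i> * complex_of_real (1 / (1 + x\<^sup>2))"
    "defic_elem (- \<i>) x = complex_of_real (x / (1 + x\<^sup>2)) - \<i> * complex_of_real (1 / (1 + x\<^sup>2))"
    using of_real_plus_i_neq[of x]
    by (simp_all add: defic_elem_def p add_divide_distrib[symmetric] diff_divide_distrib[symmetric])
qed

text \<open>
  The resolvent identity expresses \<open>1 / (x - z)\<close> by the square-integrable function \<open>1 / (x + \<i>)\<close> and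
  its product with the bounded function \<open>1 / (x - z)\<close>.
\<close>

lemma defic_elem_L2:
  assumes g: "gap z"
  shows "defic_elem z \<in> L2 \<mu>"
proof -
  let ?e = "defic_elem (- \<i>)"
  have "(\<lambda>x. ?e x + (z + \<i>) * (defic_elem z x * ?e x)) \<in> L2 \<mu>"
    by (intro L2_add L2_scale L2_mult_defic_elem defic_elem_minus_ii_L2 g)
  moreover have "AE x in \<mu>. ?e x + (z + \<i>) * (defic_elem z x * ?e x) = defic_elem z x"
    using gap_neq[OF g]
  proof eventually_elim
    case (elim x)
    show ?case unfolding defic_elem_resolvent_identity[OF elim] by simp
  qed
  ultimately show ?thesis by (intro L2_cong_AE[of _ "defic_elem z"]) auto
qed

text \<open>
  Although \<open>\<mu>\<close> may be infinite, functions in the domain of multiplication by \<open>x\<close> are integrable: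
  \<open>f\<close> is the product of \<open>(x + \<i>) f\<close> and \<open>1 / (x + \<i>)\<close>, both square-integrable.
\<close>

lemma L2_integrable_if_mult_L2:
  assumes f: "f \<in> L2 \<mu>" and xf: "(\<lambda>x. complex_of_real x * f x) \<in> L2 \<mu>"
  shows "integrable \<mu> f"
proof -
  have "(\<lambda>x. complex_of_real x * f x + \<i> * f x) \<in> L2 \<mu>"
    by (intro L2_add L2_scale f xf)
  then have "integrable \<mu> (\<lambda>x. (complex_of_real x * f x + \<i> * f x) * defic_elem (- \<i>) x)"
    by (rule L2_mult_integrable) (rule defic_elem_minus_ii_L2)
  moreover have "(complex_of_real x * f x + \<i> * f x) * defic_elem (- \<i>) x = f x" for x
    using of_real_plus_i_neq[of x] by (simp add: defic_elem_def field_simps)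
  ultimately show ?thesis by simp
qed

section \<open>The multiplication operator, its restriction and the adjoint\<close>

lemma mult_op_iff:
  "(f, k) \<in> mult_op \<mu> \<longleftrightarrow> f \<in> L2 \<mu> \<and> k \<in> L2 \<mu> \<and> (AE x in \<mu>. k x = complex_of_real x * f x)"
proof -
  have "integrable \<mu> (\<lambda>x. x\<^sup>2 * (cmod (f x))\<^sup>2)"
    if "f \<in> L2 \<mu>" "k \<in> L2 \<mu>" "AE x in \<mu>. k x = complex_of_real x * f x"
  proof -
    have [measurable]: "f \<in> borel_measurable \<mu>" using that by (simp add: L2_def)
    have "(\<lambda>x. complex_of_real x * f x) \<in> L2 \<mu>"
      by (rule L2_cong_AE[OF that(2) _ that(3)]) measurable
    then show ?thesis by (simp add: L2_def norm_mult power_mult_distrib)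
  qed
  then show ?thesis by (auto simp: mult_op_def)
qed

lemma mult_op_integrable:
  assumes "(f, k) \<in> mult_op \<mu>"
  shows "integrable \<mu> f"
proof (rule L2_integrable_if_mult_L2)
  show f: "f \<in> L2 \<mu>" using assms by (simp add: mult_op_iff)
  then have [measurable]: "f \<in> borel_measurable \<mu>" by (simp add: L2_def)
  show "(\<lambda>x. complex_of_real x * f x) \<in> L2 \<mu>"
    by (rule L2_cong_AE[of k]) (use assms in \<open>auto simp: mult_op_iff\<close>)
qed

lemma mult_op_resolvent_iff:
  assumes g: "gap z"
  shows "(h, f) \<in> resolvent \<mu> (mult_op \<mu>) z \<longleftrightarrow>
    h \<in> L2 \<mu> \<and> f \<in> L2 \<mu> \<and> (AE x in \<mu>. f x = defic_elem z x * h x)"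
proof
  assume "(h, f) \<in> resolvent \<mu> (mult_op \<mu>) z"
  then obtain k where h: "h \<in> L2 \<mu>" and fk: "(f, k) \<in> mult_op \<mu>"
    and ae: "AE x in \<mu>. h x = 1 * k x + - z * f x"
    by (auto simp: resolvent_def op_affine_def)
  have "AE x in \<mu>. k x = complex_of_real x * f x" using fk by (simp add: mult_op_iff)
  then have "AE x in \<mu>. f x = defic_elem z x * h x"
    using ae gap_neq[OF g]
    by eventually_elim (simp add: defic_elem_def field_simps)
  then show "h \<in> L2 \<mu> \<and> f \<in> L2 \<mu> \<and> (AE x in \<mu>. f x = defic_elem z x * h x)"
    using h fk by (simp add: mult_op_iff)
next
  assume A: "h \<in> L2 \<mu> \<and> f \<in> L2 \<mu> \<and> (AE x in \<mu>. f x = defic_elem z x * h x)"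
  let ?k = "\<lambda>x. h x + z * f x"
  have "AE x in \<mu>. f x = defic_elem z x * h x" using A by blast
  then have "AE x in \<mu>. ?k x = complex_of_real x * f x"
    using gap_neq[OF g]
    by eventually_elim (simp add: defic_elem_def field_simps)
  moreover have "?k \<in> L2 \<mu>" using A by (intro L2_add L2_scale) auto
  ultimately have "(f, ?k) \<in> mult_op \<mu>" using A by (simp add: mult_op_iff)
  then show "(h, f) \<in> resolvent \<mu> (mult_op \<mu>) z"
    using A by (auto simp: resolvent_def op_affine_def intro!: exI[of _ ?k])
qed

lemma bounded_set_finite_measure:
  assumes "\<delta> > 0"
  shows "integrable \<mu> (\<lambda>x. indicator {a - \<delta><..<a + \<delta>} x :: real)"
proof -
  let ?C = "1 + (\<bar>a\<bar> + \<delta>)\<^sup>2"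
  have "integrable \<mu> (\<lambda>x. ?C * (1 / (1 + x\<^sup>2)))"
    by (rule integrable_mult_right[OF poisson_integrable])
  then show ?thesis
  proof (rule Bochner_Integration.integrable_bound)
    show "AE x in \<mu>. norm (indicator {a - \<delta><..<a + \<delta>} x :: real) \<le> norm (?C * (1 / (1 + x\<^sup>2)))"
    proof (rule AE_I2)
      fix x :: real
      have p: "1 + x\<^sup>2 > 0" by (simp add: add_pos_nonneg)
      show "norm (indicator {a - \<delta><..<a + \<delta>} x :: real) \<le> norm (?C * (1 / (1 + x\<^sup>2)))"
      proof (cases "x \<in> {a - \<delta><..<a + \<delta>}")
        case True
        then have "\<bar>x\<bar> \<le> \<bar>a\<bar> + \<delta>" by auto
        then have "\<bar>x\<bar>\<^sup>2 \<le> (\<bar>a\<bar> + \<delta>)\<^sup>2" by (intro power_mono) auto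
        then show ?thesis using True p by (simp add: field_simps)
      qed auto
    qed
  qed measurable
qed

text \<open>
  A real point \<open>a\<close> of the resolvent set has a neighbourhood of measure zero.  The solution of
  \<open>(x - a) f = h\<close> for the indicator function \<open>h\<close> of the interval of radius \<open>\<delta>\<close> around \<open>a\<close> exceeds
  \<open>1 / \<delta>\<close> on that interval, which contradicts the resolvent bound \<open>C\<close> when \<open>\<delta> < 1 / C\<close>, unless the
  interval is null.  The existence of \<open>f\<close> excludes an atom at \<open>a\<close>.
\<close>

lemma gap_if_resolvent_set:
  assumes z: "z \<in> resolvent_set \<mu> (mult_op \<mu>)"
  shows "gap z"
proof (cases "Im z = 0")
  case False
  then show ?thesis by (rule gap_nonreal)
next
  case True
  then obtain a where za: "z = complex_of_real a" by (metis complex_is_Real_iff Reals_cases)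
  obtain C where C: "\<And>h f. (h, f) \<in> resolvent \<mu> (mult_op \<mu>) z \<Longrightarrow> l2_norm \<mu> f \<le> C * l2_norm \<mu> h"
    and ex: "\<And>h. h \<in> L2 \<mu> \<Longrightarrow> \<exists>f. (h, f) \<in> resolvent \<mu> (mult_op \<mu>) z"
    using z unfolding resolvent_set_def by fast
  define \<delta> where "\<delta> = 1 / (\<bar>C\<bar> + 1)"
  have d: "\<delta> > 0" by (simp add: \<delta>_def add_nonneg_pos)
  define I where "I = {a - \<delta><..<a + \<delta>}"
  define h :: "real \<Rightarrow> complex" where "h = (\<lambda>x. indicator I x)"
  have nh: "(cmod (h x))\<^sup>2 = indicator I x" for x by (simp add: h_def indicator_def)
  have ih: "integrable \<mu> (\<lambda>x. indicator I x :: real)"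
    unfolding I_def by (rule bounded_set_finite_measure[OF d])
  have hm: "h \<in> borel_measurable borel" unfolding h_def I_def by measurable
  have h: "h \<in> L2 \<mu>" using ih hm by (simp add: L2_def nh measurable_eq)
  obtain f where f: "(h, f) \<in> resolvent \<mu> (mult_op \<mu>) z" using ex[OF h] by blast
  then obtain k where fk: "(f, k) \<in> mult_op \<mu>" and ae: "AE x in \<mu>. h x = 1 * k x + - z * f x"
    by (auto simp: resolvent_def op_affine_def)
  have fi: "integrable \<mu> (\<lambda>x. (cmod (f x))\<^sup>2)" using fk by (simp add: mult_op_iff L2_def)
  have "AE x in \<mu>. k x = complex_of_real x * f x" using fk by (simp add: mult_op_iff)
  then have le: "AE x in \<mu>. (1 / \<delta>\<^sup>2) * indicator I x \<le> (cmod (f x))\<^sup>2"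
    using ae
  proof eventually_elim
    case (elim x)
    show ?case
    proof (cases "x \<in> I")
      case True
      then have "complex_of_real (x - a) * f x = 1"
        using elim by (simp add: h_def za algebra_simps)
      then have "\<bar>x - a\<bar> * cmod (f x) = 1" by (metis norm_mult norm_of_real norm_one)
      moreover have "\<bar>x - a\<bar> < \<delta>" using True by (auto simp: I_def)
      ultimately have "1 \<le> \<delta> * cmod (f x)"
        by (metis less_imp_le mult_right_mono norm_ge_zero)
      then have "1\<^sup>2 \<le> (\<delta> * cmod (f x))\<^sup>2" by (intro power_mono) auto
      then show ?thesis using True d by (simp add: field_simps power_mult_distrib)
    qed auto
  qed
  let ?m = "LINT x|\<mu>. indicator I x :: real"
  have m0: "?m \<ge> 0" by simp
  have "(1 / \<delta>\<^sup>2) * ?m = (LINT x|\<mu>. (1 / \<delta>\<^sup>2) * indicator I x)" by simp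
  also have "\<dots> \<le> (LINT x|\<mu>. (cmod (f x))\<^sup>2)"
    by (rule integral_mono_AE[OF _ fi le]) (use ih in simp)
  also have "\<dots> = (l2_norm \<mu> f)\<^sup>2" by (simp add: l2_norm_def)
  also have "\<dots> \<le> (\<bar>C\<bar> * l2_norm \<mu> h)\<^sup>2"
  proof (rule power_mono)
    have "l2_norm \<mu> f \<le> C * l2_norm \<mu> h" by (rule C[OF f])
    also have "\<dots> \<le> \<bar>C\<bar> * l2_norm \<mu> h" by (intro mult_right_mono) (auto simp: l2_norm_def)
    finally show "l2_norm \<mu> f \<le> \<bar>C\<bar> * l2_norm \<mu> h" .
  qed (simp add: l2_norm_def)
  also have "\<dots> = C\<^sup>2 * ?m" using m0 by (simp add: l2_norm_def nh power_mult_distrib)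
  finally have "((1 / \<delta>\<^sup>2) - C\<^sup>2) * ?m \<le> 0" by (simp add: algebra_simps)
  moreover have "(1 / \<delta>\<^sup>2) - C\<^sup>2 > 0"
    by (simp add: \<delta>_def power_divide power2_sum add_nonneg_pos)
  ultimately have "?m = 0" using m0 by (smt (verit) mult_pos_pos)
  then have "AE x in \<mu>. (indicator I x :: real) = 0"
    using integral_nonneg_eq_0_iff_AE[OF ih] by simp
  then have "AE x in \<mu>. \<delta> \<le> cmod (complex_of_real x - z)"
  proof eventually_elim
    case (elim x)
    then have "\<delta> \<le> \<bar>x - a\<bar>" by (auto simp: I_def indicator_def split: if_splits)
    then show ?case unfolding za by (metis norm_of_real of_real_diff)
  qed
  then show ?thesis using d unfolding gap_def by blast
qed

end

locale unit_poisson_measure = poisson_measure +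
  assumes poisson_mass: "(LINT x|\<mu>. 1 / (1 + x\<^sup>2)) = 1"
begin

lemma inner_defic_elem_ii: "l2_inner \<mu> (defic_elem \<i>) (defic_elem \<i>) = 1"
proof -
  have "l2_inner \<mu> (defic_elem \<i>) (defic_elem \<i>) = (LINT x|\<mu>. complex_of_real ((cmod (defic_elem \<i> x))\<^sup>2))"
    unfolding l2_inner_def by (simp only: complex_norm_square)
  also have "\<dots> = complex_of_real (LINT x|\<mu>. 1 / (1 + x\<^sup>2))"
    unfolding defic_elem_ii_norm by (rule integral_complex_of_real)
  finally show ?thesis using poisson_mass by simp
qed

text \<open>
  With \<open>u = w / (x + \<i>)\<close>, the adjoint relation for \<open>(f, k)\<close> says that \<open>w\<close> is orthogonal to
  \<open>q = (k - x f) / (x - \<i>)\<close> whenever it is orthogonal to \<open>1 / (x - \<i>)\<close>.  Hence \<open>q\<close> is a multiple of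
  \<open>1 / (x - \<i>)\<close>, and \<open>k - x f\<close> is constant.
\<close>

lemma adjoint_sym_op_iff:
  "(f, k) \<in> op_adjoint \<mu> (sym_op \<mu>) \<longleftrightarrow>
    f \<in> L2 \<mu> \<and> k \<in> L2 \<mu> \<and> (\<exists>c. AE x in \<mu>. k x = complex_of_real x * f x + c)"
proof
  assume A: "(f, k) \<in> op_adjoint \<mu> (sym_op \<mu>)"
  then have f: "f \<in> L2 \<mu>" and k: "k \<in> L2 \<mu>"
    and adj: "\<And>u v. (u, v) \<in> sym_op \<mu> \<Longrightarrow> l2_inner \<mu> v f = l2_inner \<mu> u k"
    by (auto simp: op_adjoint_def)
  have gi: "gap \<i>" "gap (- \<i>)" by (auto intro: gap_nonreal)
  \<comment> \<open>This is \<open>(k - x f) / (x - \<i>)\<close>, written so that its square-integrability is visible.\<close>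
  define q where "q = (\<lambda>x. defic_elem \<i> x * (k x - \<i> * f x) - f x)"
  have q: "q \<in> L2 \<mu>" unfolding q_def by (intro L2_diff L2_mult_defic_elem L2_scale f k gi)
  have "\<exists>c. AE x in \<mu>. q x = c * defic_elem \<i> x"
  proof (rule proportional_if_annihilated[OF defic_elem_L2[OF gi(1)] q inner_defic_elem_ii])
    fix w assume w: "w \<in> L2 \<mu>" and we: "l2_inner \<mu> w (defic_elem \<i>) = 0"
    define u where "u = (\<lambda>x. defic_elem (- \<i>) x * w x)"
    define v where "v = (\<lambda>x. w x - \<i> * u x)"
    have u: "u \<in> L2 \<mu>" unfolding u_def by (intro L2_mult_defic_elem w gi)
    have v: "v \<in> L2 \<mu>" unfolding v_def by (intro L2_diff L2_scale w u)
    have vu: "v x = complex_of_real x * u x" for x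
      using of_real_plus_i_neq[of x] by (simp add: v_def u_def defic_elem_def field_simps)
    have "(LINT x|\<mu>. u x) = l2_inner \<mu> w (defic_elem \<i>)"
      unfolding l2_inner_def u_def defic_elem_cnj by (simp add: mult.commute)
    then have "(u, v) \<in> sym_op \<mu>"
      using u v vu we by (simp add: sym_op_def mult_op_iff)
    then have eq: "l2_inner \<mu> u k = l2_inner \<mu> v f" using adj by simp
    have "l2_inner \<mu> w q = (LINT x|\<mu>. u x * cnj (k x) - v x * cnj (f x))"
      unfolding l2_inner_def
    proof (intro arg_cong[where f = "lebesgue_integral \<mu>"] ext)
      fix x
      show "w x * cnj (q x) = u x * cnj (k x) - v x * cnj (f x)"
        by (simp add: q_def v_def u_def defic_elem_cnj algebra_simps)
    qed
    also have "\<dots> = l2_inner \<mu> u k - l2_inner \<mu> v f"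
      unfolding l2_inner_def
      by (subst Bochner_Integration.integral_diff) (auto intro!: L2_inner_integrable u v f k)
    finally show "l2_inner \<mu> w q = 0" using eq by simp
  qed
  then obtain c where "AE x in \<mu>. q x = c * defic_elem \<i> x" by blast
  then have "AE x in \<mu>. k x = complex_of_real x * f x + c"
  proof eventually_elim
    case (elim x)
    then show ?case using of_real_plus_i_neq[of x]
      by (simp add: q_def defic_elem_def field_simps)
  qed
  then show "f \<in> L2 \<mu> \<and> k \<in> L2 \<mu> \<and> (\<exists>c. AE x in \<mu>. k x = complex_of_real x * f x + c)"
    using f k by blast
next
  assume "f \<in> L2 \<mu> \<and> k \<in> L2 \<mu> \<and> (\<exists>c. AE x in \<mu>. k x = complex_of_real x * f x + c)"
  then obtain c where f: "f \<in> L2 \<mu>" and k: "k \<in> L2 \<mu>"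
    and ae: "AE x in \<mu>. k x = complex_of_real x * f x + c" by blast
  have "l2_inner \<mu> v f = l2_inner \<mu> u k" if uv: "(u, v) \<in> sym_op \<mu>" for u v
  proof -
    have uvm: "(u, v) \<in> mult_op \<mu>" and iu: "(LINT x|\<mu>. u x) = 0"
      using uv by (auto simp: sym_op_def)
    have u: "u \<in> L2 \<mu>" and v: "v \<in> L2 \<mu>"
      and vae: "AE x in \<mu>. v x = complex_of_real x * u x"
      using uvm by (auto simp: mult_op_iff)
    have ui: "integrable \<mu> u" by (rule mult_op_integrable[OF uvm])
    have [measurable]: "u \<in> borel_measurable \<mu>" "v \<in> borel_measurable \<mu>"
      "f \<in> borel_measurable \<mu>" "k \<in> borel_measurable \<mu>"
      using u v f k by (simp_all add: L2_def)
    have "l2_inner \<mu> u k = (LINT x|\<mu>. v x * cnj (f x) + cnj c * u x)"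
      unfolding l2_inner_def
    proof (rule integral_cong_AE)
      show "AE x in \<mu>. u x * cnj (k x) = v x * cnj (f x) + cnj c * u x"
        using ae vae by eventually_elim (simp add: algebra_simps)
    qed measurable
    also have "\<dots> = l2_inner \<mu> v f + cnj c * (LINT x|\<mu>. u x)"
      unfolding l2_inner_def
      by (subst Bochner_Integration.integral_add) (auto intro!: L2_inner_integrable v f ui)
    finally show ?thesis using iu by simp
  qed
  then show "(f, k) \<in> op_adjoint \<mu> (sym_op \<mu>)" using f k by (auto simp: op_adjoint_def)
qed

lemma defic_elem_in_deficiency_space:
  assumes g: "gap z"
  shows "defic_elem z \<in> deficiency_space \<mu> (sym_op \<mu>) z"
proof -
  have "AE x in \<mu>. z * defic_elem z x = complex_of_real x * defic_elem z x + - 1"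
    using gap_neq[OF g] by eventually_elim (simp add: defic_elem_def field_simps)
  then show ?thesis
    unfolding deficiency_space_def
    by (auto simp: adjoint_sym_op_iff intro!: defic_elem_L2 L2_scale g)
qed

lemma deficiency_space_multiple:
  assumes g: "gap z" and d: "d \<in> deficiency_space \<mu> (sym_op \<mu>) z"
  shows "\<exists>c. AE x in \<mu>. d x = c * defic_elem z x"
proof -
  obtain c where "AE x in \<mu>. z * d x = complex_of_real x * d x + c"
    using d by (auto simp: deficiency_space_def adjoint_sym_op_iff)
  then have "AE x in \<mu>. d x = (- c) * defic_elem z x"
    using gap_neq[OF g]
    by eventually_elim (simp add: defic_elem_def field_simps add_eq_0_iff2)
  then show ?thesis by blast
qed


section \<open>The Nevanlinna function of the measure\<close>

text \<open>
  The right-hand side of the integral representation of \<open>M\<close>, here as a function on all points of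
  the complex plane.
\<close>

definition nevanlinna :: "complex \<Rightarrow> complex" where
  "nevanlinna z = (LINT x|\<mu>. defic_elem z x - complex_of_real (x / (1 + x\<^sup>2)))"

lemma nevanlinna_integrand:
  assumes "complex_of_real x - z \<noteq> 0"
  shows "defic_elem z x - complex_of_real (x / (1 + x\<^sup>2)) =
    (1 + z * complex_of_real x) * defic_elem z x * complex_of_real (1 / (1 + x\<^sup>2))"
proof -
  have "1 + x\<^sup>2 \<noteq> 0" by (metis add_pos_nonneg less_irrefl zero_le_power2 zero_less_one)
  then have "1 + (complex_of_real x)\<^sup>2 \<noteq> 0"
    by (metis of_real_1 of_real_add of_real_eq_0_iff of_real_power)
  then show ?thesis using assms
    by (simp add: defic_elem_def divide_simps) (simp add: power2_eq_square algebra_simps)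
qed

lemma nevanlinna_integrable:
  assumes g: "gap z"
  shows "integrable \<mu> (\<lambda>x. defic_elem z x - complex_of_real (x / (1 + x\<^sup>2)))"
proof -
  have "integrable \<mu> (\<lambda>x. defic_elem z x * defic_elem (- \<i>) x)"
    by (intro L2_mult_integrable defic_elem_L2 g gap_nonreal) simp
  moreover have "integrable \<mu> (\<lambda>x. complex_of_real (1 / (1 + x\<^sup>2)))"
    by (intro integrable_of_real poisson_integrable)
  ultimately have "integrable \<mu> (\<lambda>x. (z + \<i>) * (defic_elem z x * defic_elem (- \<i>) x) -
      \<i> * complex_of_real (1 / (1 + x\<^sup>2)))"
    by (intro Bochner_Integration.integrable_diff integrable_mult_right)
  then show ?thesis
  proof (rule integrable_cong_AE_imp)
    show "AE x in \<mu>. (z + \<i>) * (defic_elem z x * defic_elem (- \<i>) x) -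
      \<i> * complex_of_real (1 / (1 + x\<^sup>2)) = defic_elem z x - complex_of_real (x / (1 + x\<^sup>2))"
      using gap_neq[OF g]
      by eventually_elim (subst defic_elem_resolvent_identity, simp, simp add: defic_elem_ii_eq(2))
  qed measurable
qed

lemma nevanlinna_cnj: "nevanlinna (cnj z) = cnj (nevanlinna z)"
  unfolding nevanlinna_def
  by (subst Bochner_Integration.integral_cnj[symmetric]) (simp add: defic_elem_cnj)

text \<open>
  Difference quotients of \<open>1 / (x - z)\<close> differ from the derivative \<open>1 / (x - z)\<^sup>2\<close> by
  \<open>(w - z) / ((x - w) (x - z)\<^sup>2)\<close>.  On a gap the factor \<open>1 / (x - w)\<close> is bounded uniformly in \<open>w\<close>
  near \<open>z\<close>, and the rest is integrable.
\<close>

lemma nevanlinna_has_derivative: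
  assumes g: "gap z"
  shows "(nevanlinna has_field_derivative (LINT x|\<mu>. defic_elem z x * defic_elem z x)) (at z)"
proof -
  let ?D = "LINT x|\<mu>. defic_elem z x * defic_elem z x"
  let ?R = "LINT x|\<mu>. (cmod (defic_elem z x))\<^sup>2"
  obtain \<delta> where d: "\<delta> > 0" and ae: "AE x in \<mu>. \<delta> \<le> cmod (complex_of_real x - z)"
    using g unfolding gap_def by auto
  have L: "defic_elem z \<in> L2 \<mu>" by (rule defic_elem_L2[OF g])
  have sq: "integrable \<mu> (\<lambda>x. (cmod (defic_elem z x))\<^sup>2)" using L by (simp add: L2_def)
  have prod: "integrable \<mu> (\<lambda>x. defic_elem z x * defic_elem z x)" by (intro L2_mult_integrable L)
  have est: "cmod ((nevanlinna w - nevanlinna z) / (w - z) - ?D) \<le> cmod (w - z) * (2 / \<delta> * ?R)"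
    if w: "cmod (w - z) < \<delta> / 2" "w \<noteq> z" for w
  proof -
    have aew: "AE x in \<mu>. \<delta> / 2 \<le> cmod (complex_of_real x - w)"
      by (rule gap_radius_halved[OF ae w(1)])
    then have gw: "gap w" unfolding gap_def using d by (intro exI[of _ "\<delta> / 2"]) auto
    let ?q = "\<lambda>x. ((defic_elem w x - complex_of_real (x / (1 + x\<^sup>2))) -
       (defic_elem z x - complex_of_real (x / (1 + x\<^sup>2)))) / (w - z) - defic_elem z x * defic_elem z x"
    have "(nevanlinna w - nevanlinna z) / (w - z) - ?D = (LINT x|\<mu>. ?q x)"
      unfolding nevanlinna_def
      using nevanlinna_integrable[OF gw] nevanlinna_integrable[OF g] prod
      by (simp only: Bochner_Integration.integral_diff Bochner_Integration.integrable_diff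
          integral_divide_zero integrable_divide)
    also have "cmod \<dots> \<le> (LINT x|\<mu>. cmod (w - z) * (2 / \<delta> * (cmod (defic_elem z x))\<^sup>2))"
    proof (rule order_trans[OF integral_norm_bound integral_mono_AE])
      show "integrable \<mu> (\<lambda>x. cmod (?q x))"
        by (intro integrable_norm Bochner_Integration.integrable_diff integrable_divide nevanlinna_integrable gw g prod)
      show "integrable \<mu> (\<lambda>x. cmod (w - z) * (2 / \<delta> * (cmod (defic_elem z x))\<^sup>2))"
        by (intro integrable_mult_right sq)
      show "AE x in \<mu>. cmod (?q x) \<le> cmod (w - z) * (2 / \<delta> * (cmod (defic_elem z x))\<^sup>2)"
        using aew gap_neq[OF gw] gap_neq[OF g]
      proof eventually_elim
        case (elim x)
        have "(1 / a - 1 / b) / (b - a) - 1 / b * (1 / b) = (b - a) * (1 / a * (1 / b * (1 / b)))"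
          if "a \<noteq> 0" "b \<noteq> 0" "b - a \<noteq> 0" for a b :: complex
          using that by (simp add: divide_simps)
        from this[OF elim(2,3)] w(2)
        have "?q x = (w - z) * (defic_elem w x * (defic_elem z x * defic_elem z x))"
          by (simp add: defic_elem_def)
        then have "cmod (?q x) = cmod (w - z) * (cmod (defic_elem w x) * (cmod (defic_elem z x))\<^sup>2)"
          by (simp add: norm_mult power2_eq_square)
        moreover have "cmod (defic_elem w x) \<le> 2 / \<delta>"
          using frac_le[of 1 1 "\<delta> / 2" "cmod (complex_of_real x - w)"] elim(1) d
          by (simp add: defic_elem_def norm_divide)
        ultimately show ?case by (simp only:) (intro mult_left_mono mult_right_mono; simp)
      qed
    qed
    finally show ?thesis by simp
  qed
  have "((\<lambda>w. (nevanlinna w - nevanlinna z) / (w - z) - ?D) \<longlongrightarrow> 0) (at z)"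
  proof (rule Lim_null_comparison)
    have "eventually (\<lambda>w. w \<in> ball z (\<delta> / 2) \<and> w \<noteq> z) (at z)"
      using d eventually_at_ball'[of "\<delta> / 2" z UNIV] by simp
    then show "eventually (\<lambda>w. norm ((nevanlinna w - nevanlinna z) / (w - z) - ?D)
      \<le> cmod (w - z) * (2 / \<delta> * ?R)) (at z)"
      by eventually_elim (rule est; simp add: dist_norm norm_minus_commute)
    have "((\<lambda>w. cmod (w - z) * (2 / \<delta> * ?R)) \<longlongrightarrow> cmod (z - z) * (2 / \<delta> * ?R)) (at z)"
      by (intro tendsto_intros)
    then show "((\<lambda>w. cmod (w - z) * (2 / \<delta> * ?R)) \<longlongrightarrow> 0) (at z)" by simp
  qed
  then show ?thesis by (simp add: has_field_derivative_iff Lim_null[of _ ?D])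
qed

section \<open>The Weyl-Titchmarsh function\<close>

text \<open>
  The form equals \<open>\<integral> (1 + z x) / (x - z) \<bar>d\<bar>\<^sup>2 d\<mu>\<close>, and \<open>\<bar>d\<bar>\<^sup>2 = 1 / (1 + x\<^sup>2)\<close> because
  \<open>d\<close> is a multiple of the unit vector \<open>1 / (x - \<i>)\<close>.
\<close>

lemma weyl_form_eq_nevanlinna:
  assumes im: "Im z \<noteq> 0" and d: "d \<in> deficiency_space \<mu> (sym_op \<mu>) \<i>" and n: "l2_norm \<mu> d = 1"
  shows "weyl_form \<mu> (mult_op \<mu>) d z = nevanlinna z"
proof -
  have gz: "gap z" by (rule gap_nonreal[OF im])
  have gi: "gap \<i>" by (rule gap_nonreal) simp
  have dL: "d \<in> L2 \<mu>" using d by (auto simp: deficiency_space_def adjoint_sym_op_iff)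
  obtain c where c: "AE x in \<mu>. d x = c * defic_elem \<i> x"
    using deficiency_space_multiple[OF gi d] by blast
  have nd: "AE x in \<mu>. (cmod (d x))\<^sup>2 = (cmod c)\<^sup>2 * (1 / (1 + x\<^sup>2))"
    using c by eventually_elim (simp only: norm_mult power_mult_distrib defic_elem_ii_norm)
  have "(LINT x|\<mu>. (cmod (d x))\<^sup>2) = (LINT x|\<mu>. (cmod c)\<^sup>2 * (1 / (1 + x\<^sup>2)))"
    by (rule integral_cong_AE[OF _ _ nd]) (use dL in \<open>auto simp: L2_def\<close>)
  also have "\<dots> = (cmod c)\<^sup>2 * (LINT x|\<mu>. 1 / (1 + x\<^sup>2))"
    by (rule integral_mult_right_zero)
  finally have cc: "(cmod c)\<^sup>2 = 1" using n poisson_mass by (simp add: l2_norm_def)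
  let ?R = "\<lambda>k. (d, k) \<in> resolvent \<mu> (mult_op \<mu>) z O op_affine \<mu> z 1 (mult_op \<mu>)"
  define f where "f = (\<lambda>x. defic_elem z x * d x)"
  define h where "h = (\<lambda>x. d x + z * f x)"
  have fL: "f \<in> L2 \<mu>" unfolding f_def by (intro L2_mult_defic_elem gz dL)
  have hL: "h \<in> L2 \<mu>" unfolding h_def by (intro L2_add L2_scale fL dL)
  have "AE x in \<mu>. h x = complex_of_real x * f x"
    using gap_neq[OF gz] by eventually_elim (simp add: h_def f_def defic_elem_def field_simps)
  then have fh: "(f, h) \<in> mult_op \<mu>" using fL hL by (simp add: mult_op_iff)
  have "(d, f) \<in> resolvent \<mu> (mult_op \<mu>) z"
    using dL fL by (simp add: mult_op_resolvent_iff[OF gz] f_def)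
  moreover have "(f, \<lambda>x. z * h x + 1 * f x) \<in> op_affine \<mu> z 1 (mult_op \<mu>)"
  proof -
    have "(\<lambda>x. z * h x + 1 * f x) \<in> L2 \<mu>" by (intro L2_add L2_scale fL hL)
    then show ?thesis using fh unfolding op_affine_def by auto
  qed
  ultimately have ex: "?R (\<lambda>x. z * h x + 1 * f x)" by blast
  define k where "k = (SOME k. ?R k)"
  have "?R k" unfolding k_def by (rule someI[of ?R, OF ex])
  then obtain f' where f': "(d, f') \<in> resolvent \<mu> (mult_op \<mu>) z"
    and k': "(f', k) \<in> op_affine \<mu> z 1 (mult_op \<mu>)" by blast
  then obtain h' where kL: "k \<in> L2 \<mu>" and fh': "(f', h') \<in> mult_op \<mu>"
    and kae: "AE x in \<mu>. k x = z * h' x + 1 * f' x"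
    by (auto simp: op_affine_def)
  have f'ae: "AE x in \<mu>. f' x = defic_elem z x * d x"
    using f' by (simp add: mult_op_resolvent_iff[OF gz])
  have h'ae: "AE x in \<mu>. h' x = complex_of_real x * f' x"
    using fh' by (simp add: mult_op_iff)
  have "l2_inner \<mu> k d = nevanlinna z"
    unfolding l2_inner_def nevanlinna_def
  proof (rule integral_cong_AE)
    show "AE x in \<mu>. k x * cnj (d x) = defic_elem z x - complex_of_real (x / (1 + x\<^sup>2))"
      using kae f'ae h'ae nd gap_neq[OF gz]
    proof eventually_elim
      case (elim x)
      have "k x * cnj (d x) = (1 + z * complex_of_real x) * defic_elem z x * (d x * cnj (d x))"
        using elim(1-3) by (simp add: algebra_simps)
      also have "d x * cnj (d x) = complex_of_real (1 / (1 + x\<^sup>2))"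
        unfolding complex_norm_square[symmetric] using elim(4) cc by simp
      finally show ?case unfolding nevanlinna_integrand[OF elim(5)] .
    qed
  qed (use kL dL in \<open>auto intro!: borel_measurable_integrable L2_inner_integrable\<close>)
  then show ?thesis unfolding weyl_form_def k_def .
qed

lemma weyl_nonreal_eq_nevanlinna:
  assumes "Im z \<noteq> 0" "d \<in> deficiency_space \<mu> (sym_op \<mu>) \<i>" "l2_norm \<mu> d = 1"
  shows "weyl_nonreal \<mu> (mult_op \<mu>) d z = nevanlinna z"
  using assms weyl_form_eq_nevanlinna[of z d] weyl_form_eq_nevanlinna[of "cnj z" d]
  by (simp add: weyl_nonreal_def nevanlinna_cnj)

text \<open>
  At a real point, any two continuations are continuous and agree at the nonreal points
  approaching it vertically, so the value \<open>N(z)\<close> of one of them is the value of all.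
\<close>

lemma weyl_titchmarsh_eq_nevanlinna:
  assumes g: "gap z" and d: "d \<in> deficiency_space \<mu> (sym_op \<mu>) \<i>" "l2_norm \<mu> d = 1"
  shows "weyl_titchmarsh \<mu> (mult_op \<mu>) d z = nevanlinna z"
proof (cases "Im z = 0")
  case False
  then show ?thesis by (simp add: weyl_titchmarsh_def weyl_nonreal_eq_nevanlinna d)
next
  case True
  let ?P = "\<lambda>w. \<exists>r > 0. \<exists>F. F holomorphic_on ball z r \<and>
    (\<forall>\<zeta> \<in> ball z r. Im \<zeta> \<noteq> 0 \<longrightarrow> F \<zeta> = weyl_nonreal \<mu> (mult_op \<mu>) d \<zeta>) \<and> F z = w"
  obtain r where r: "r > 0" and gr: "\<forall>w\<in>ball z r. gap w" using gap_open[OF g] by blast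
  have "nevanlinna holomorphic_on ball z r"
    using nevanlinna_has_derivative gr by (auto simp: holomorphic_on_open)
  then have P: "?P (nevanlinna z)"
    using r by (intro exI[of _ r] conjI exI[of _ nevanlinna]) (auto simp: weyl_nonreal_eq_nevanlinna d)
  have "w = nevanlinna z" if Pw: "?P w" for w
  proof -
    obtain \<rho> F where \<rho>: "\<rho> > 0" and F: "F holomorphic_on ball z \<rho>" "F z = w"
      and agree: "\<And>\<zeta>. \<zeta> \<in> ball z \<rho> \<Longrightarrow> Im \<zeta> \<noteq> 0 \<Longrightarrow> F \<zeta> = weyl_nonreal \<mu> (mult_op \<mu>) d \<zeta>"
      using Pw by blast
    define \<zeta> where "\<zeta> n = z + \<i> * complex_of_real (1 / real (Suc n))" for n
    have l0: "(\<lambda>n. 1 / real (Suc n)) \<longlonglongrightarrow> 0" by (rule LIMSEQ_Suc[OF lim_1_over_n])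
    have "\<zeta> \<longlonglongrightarrow> z + \<i> * complex_of_real 0"
      unfolding \<zeta>_def by (intro tendsto_intros l0)
    then have lim: "\<zeta> \<longlonglongrightarrow> z" by simp
    have "isCont F z"
      using F(1) \<rho> holomorphic_on_imp_continuous_on continuous_on_eq_continuous_at[of "ball z \<rho>" F]
      by auto
    then have "(\<lambda>n. F (\<zeta> n)) \<longlonglongrightarrow> w"
      using F(2) isCont_tendsto_compose[OF _ lim] by blast
    moreover have "(\<lambda>n. nevanlinna (\<zeta> n)) \<longlonglongrightarrow> nevanlinna z"
      by (rule isCont_tendsto_compose[OF DERIV_isCont[OF nevanlinna_has_derivative[OF g]] lim])
    moreover have "eventually (\<lambda>n. F (\<zeta> n) = nevanlinna (\<zeta> n)) sequentially"
    proof -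
      have "eventually (\<lambda>n. \<zeta> n \<in> ball z \<rho>) sequentially"
        using lim \<rho> by (intro topological_tendstoD) auto
      then show ?thesis
      proof eventually_elim
        case (elim n)
        have "Im (\<zeta> n) \<noteq> 0" using True by (simp add: \<zeta>_def)
        then show ?case using agree[OF elim] weyl_nonreal_eq_nevanlinna d by simp
      qed
    qed
    ultimately show ?thesis by (metis LIMSEQ_unique tendsto_cong)
  qed
  with P have "(THE w. ?P w) = nevanlinna z" by (rule the_equality)
  then show ?thesis using True by (simp add: weyl_titchmarsh_def)
qed

section \<open>The dissipative operator\<close>

lemma const_not_L2:
  assumes inf: "emeasure \<mu> (space \<mu>) = \<infinity>" and c: "(\<lambda>x. c) \<in> L2 \<mu>"
  shows "c = 0"
proof (rule ccontr)
  assume "c \<noteq> 0"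
  then have "(\<lambda>x. 1 / c * c) = (\<lambda>x::real. 1)" by auto
  then have "(\<lambda>x. 1) \<in> L2 \<mu>" using L2_scale[OF c, of "1 / c"] by simp
  then have "integrable \<mu> (\<lambda>x. 1 :: real)" by (simp add: L2_def)
  then have "emeasure \<mu> (space \<mu>) < \<infinity>"
    using integrable_iff_bounded[of \<mu> "\<lambda>x. 1 :: real"] by simp
  then show False using inf by simp
qed

text \<open>
  The deficiency vector that enlarges the domain, normalised so that \<open>x b\<^sub>\<kappa> - 1\<close> is
  square-integrable.  The constant \<open>a\<close> in \<open>k = x f - a\<close> is then the coefficient of this vector in \<open>f\<close>.
\<close>

definition boundary_elem :: "complex \<Rightarrow> real \<Rightarrow> complex" where
  "boundary_elem \<kappa> x = (defic_elem \<i> x - \<kappa> * defic_elem (- \<i>) x) / (1 - \<kappa>)"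

lemma boundary_elem_eq:
  assumes "\<kappa> \<noteq> 1"
  shows "boundary_elem \<kappa> x =
    complex_of_real (x / (1 + x\<^sup>2)) + \<i> * ((1 + \<kappa>) / (1 - \<kappa>)) * complex_of_real (1 / (1 + x\<^sup>2))"
proof -
  have "((r + \<i> * t) - \<kappa> * (r - \<i> * t)) / (1 - \<kappa>) = r + \<i> * ((1 + \<kappa>) / (1 - \<kappa>)) * t" for r t
    using assms by (simp add: divide_simps) (simp add: algebra_simps)
  then show ?thesis unfolding boundary_elem_def defic_elem_ii_eq .
qed

lemma boundary_elem_L2: "boundary_elem \<kappa> \<in> L2 \<mu>"
proof -
  have "(\<lambda>x. 1 / (1 - \<kappa>) * (defic_elem \<i> x - \<kappa> * defic_elem (- \<i>) x)) \<in> L2 \<mu>"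
    by (intro L2_scale L2_diff defic_elem_L2 gap_nonreal) auto
  then show ?thesis by (simp add: boundary_elem_def[abs_def])
qed

lemma mult_boundary_elem_minus_one_L2:
  assumes "\<kappa> \<noteq> 1"
  shows "(\<lambda>x. complex_of_real x * boundary_elem \<kappa> x - 1) \<in> L2 \<mu>"
proof -
  have "(\<lambda>x. \<i> / (1 - \<kappa>) * (defic_elem \<i> x + \<kappa> * defic_elem (- \<i>) x)) \<in> L2 \<mu>"
    by (intro L2_scale L2_add defic_elem_L2 gap_nonreal) auto
  moreover have "\<i> / (1 - \<kappa>) * (defic_elem \<i> x + \<kappa> * defic_elem (- \<i>) x) =
      complex_of_real x * boundary_elem \<kappa> x - 1" for x
  proof -
    have "complex_of_real x * defic_elem \<i> x = 1 + \<i> * defic_elem \<i> x"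
      "complex_of_real x * defic_elem (- \<i>) x = 1 - \<i> * defic_elem (- \<i>) x"
      using of_real_plus_i_neq[of x] by (simp_all add: defic_elem_def field_simps)
    note this[simp]
    have "complex_of_real x * (defic_elem \<i> x - \<kappa> * defic_elem (- \<i>) x) =
      complex_of_real x * defic_elem \<i> x - \<kappa> * (complex_of_real x * defic_elem (- \<i>) x)"
      by (simp only: algebra_simps)
    also have "\<dots> = (1 - \<kappa>) + \<i> * (defic_elem \<i> x + \<kappa> * defic_elem (- \<i>) x)"
      by simp (simp add: algebra_simps)
    finally have "complex_of_real x * boundary_elem \<kappa> x =
      ((1 - \<kappa>) + \<i> * (defic_elem \<i> x + \<kappa> * defic_elem (- \<i>) x)) / (1 - \<kappa>)"
      by (simp only: boundary_elem_def times_divide_eq_right)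
    then show ?thesis using assms by (simp add: add_divide_distrib)
  qed
  ultimately show ?thesis by simp
qed

text \<open>
  Subtracting the multiple \<open>a b\<^sub>\<kappa>\<close> from \<open>f\<close> must leave an element of the domain of the symmetric
  operator.  That \<open>x (f - a b\<^sub>\<kappa>)\<close> is square-integrable fixes \<open>a\<close> as the constant in \<open>k = x f - a\<close>,
  because a nonzero constant is not square-integrable; what remains is the vanishing of the integral.
\<close>

lemma dissip_op_iff:
  assumes inf: "emeasure \<mu> (space \<mu>) = \<infinity>" and \<kappa>: "\<kappa> \<noteq> 1"
  shows "(f, k) \<in> dissip_op \<mu> \<kappa> \<longleftrightarrow> f \<in> L2 \<mu> \<and> k \<in> L2 \<mu> \<and>
    (\<exists>a. (AE x in \<mu>. k x = complex_of_real x * f x - a) \<and>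
         (LINT x|\<mu>. f x - a * boundary_elem \<kappa> x) = 0)"
proof
  assume A: "(f, k) \<in> dissip_op \<mu> \<kappa>"
  then have f: "f \<in> L2 \<mu>" and k: "k \<in> L2 \<mu>" by (auto simp: dissip_op_def adjoint_sym_op_iff)
  from A obtain b where b: "AE x in \<mu>. k x = complex_of_real x * f x + b"
    by (auto simp: dissip_op_def adjoint_sym_op_iff)
  from A obtain u v c where uv: "(u, v) \<in> mult_op \<mu>" and iu: "(LINT x|\<mu>. u x) = 0"
    and fu: "AE x in \<mu>. f x = u x + c * (defic_elem \<i> x - \<kappa> * defic_elem (- \<i>) x)"
    by (auto simp: dissip_op_def sym_op_def)
  define a where "a = c * (1 - \<kappa>)"
  have fu': "AE x in \<mu>. f x - a * boundary_elem \<kappa> x = u x"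
    using fu by eventually_elim (use \<kappa> in \<open>simp add: a_def boundary_elem_def\<close>)
  have u: "u \<in> L2 \<mu>" and v: "v \<in> L2 \<mu>" and vu: "AE x in \<mu>. v x = complex_of_real x * u x"
    using uv by (auto simp: mult_op_iff)
  have "(\<lambda>x. k x - v x - a * (complex_of_real x * boundary_elem \<kappa> x - 1)) \<in> L2 \<mu>"
    by (intro L2_diff L2_scale k v mult_boundary_elem_minus_one_L2 \<kappa>)
  moreover have "AE x in \<mu>. k x - v x - a * (complex_of_real x * boundary_elem \<kappa> x - 1) = a + b"
    using b vu fu'
  proof eventually_elim
    case (elim x)
    have "f x = u x + a * boundary_elem \<kappa> x" using elim(3) by (simp add: algebra_simps)
    then show ?case using elim(1,2) by (simp add: algebra_simps)
  qed
  ultimately have "(\<lambda>x. a + b) \<in> L2 \<mu>" by (intro L2_cong_AE[of _ "\<lambda>x. a + b"]) auto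
  then have "a + b = 0" by (rule const_not_L2[OF inf])
  then have "b = - a" by (simp add: add_eq_0_iff)
  then have "AE x in \<mu>. k x = complex_of_real x * f x - a" using b by simp
  moreover have "(LINT x|\<mu>. f x - a * boundary_elem \<kappa> x) = (LINT x|\<mu>. u x)"
    by (rule integral_cong_AE[OF _ _ fu'])
      (use f u boundary_elem_L2[of \<kappa>] in \<open>auto simp: L2_def\<close>)
  ultimately show "f \<in> L2 \<mu> \<and> k \<in> L2 \<mu> \<and>
    (\<exists>a. (AE x in \<mu>. k x = complex_of_real x * f x - a) \<and>
         (LINT x|\<mu>. f x - a * boundary_elem \<kappa> x) = 0)"
    using f k iu by auto
next
  assume "f \<in> L2 \<mu> \<and> k \<in> L2 \<mu> \<and>
    (\<exists>a. (AE x in \<mu>. k x = complex_of_real x * f x - a) \<and>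
         (LINT x|\<mu>. f x - a * boundary_elem \<kappa> x) = 0)"
  then obtain a where f: "f \<in> L2 \<mu>" and k: "k \<in> L2 \<mu>"
    and ka: "AE x in \<mu>. k x = complex_of_real x * f x - a"
    and i0: "(LINT x|\<mu>. f x - a * boundary_elem \<kappa> x) = 0" by blast
  define u where "u = (\<lambda>x. f x - a * boundary_elem \<kappa> x)"
  define v where "v = (\<lambda>x. k x - a * (complex_of_real x * boundary_elem \<kappa> x - 1))"
  have "u \<in> L2 \<mu>" unfolding u_def by (intro L2_diff L2_scale f boundary_elem_L2)
  moreover have "v \<in> L2 \<mu>"
    unfolding v_def by (intro L2_diff L2_scale k mult_boundary_elem_minus_one_L2 \<kappa>)
  moreover have "AE x in \<mu>. v x = complex_of_real x * u x"
    using ka by eventually_elim (simp add: u_def v_def algebra_simps)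
  ultimately have "(u, v) \<in> sym_op \<mu>"
    using i0 by (simp add: sym_op_def mult_op_iff u_def)
  then have "u \<in> Domain (sym_op \<mu>)" by blast
  moreover have "f x = u x + a / (1 - \<kappa>) * (defic_elem \<i> x - \<kappa> * defic_elem (- \<i>) x)" for x
    by (simp add: u_def boundary_elem_def)
  moreover have "(f, k) \<in> op_adjoint \<mu> (sym_op \<mu>)"
    unfolding adjoint_sym_op_iff using f k ka by (auto intro!: exI[of _ "- a"])
  ultimately show "(f, k) \<in> dissip_op \<mu> \<kappa>" unfolding dissip_op_def by blast
qed

lemma integral_defic_minus_boundary_elem:
  assumes g: "gap z" and \<kappa>: "\<kappa> \<noteq> 1"
  shows "integrable \<mu> (\<lambda>x. defic_elem z x - boundary_elem \<kappa> x)" (is ?I)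
    and "(LINT x|\<mu>. defic_elem z x - boundary_elem \<kappa> x) =
      nevanlinna z + \<i> * ((\<kappa> + 1) / (\<kappa> - 1))" (is ?E)
proof -
  let ?c = "\<i> * ((\<kappa> + 1) / (\<kappa> - 1))"
  have "(1 + \<kappa>) / (1 - \<kappa>) = - ((\<kappa> + 1) / (\<kappa> - 1))"
    by (metis add.commute minus_diff_eq minus_divide_right)
  then have c: "\<i> * ((1 + \<kappa>) / (1 - \<kappa>)) = - ?c" by simp
  have eq: "defic_elem z x - boundary_elem \<kappa> x =
    (defic_elem z x - complex_of_real (x / (1 + x\<^sup>2))) + ?c * complex_of_real (1 / (1 + x\<^sup>2))" for x
  proof -
    have "d - (r + - c * t) = (d - r) + c * t" for d r c t :: complex by simp
    then show ?thesis unfolding boundary_elem_eq[OF \<kappa>] c .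
  qed
  have i: "integrable \<mu> (\<lambda>x. ?c * complex_of_real (1 / (1 + x\<^sup>2)))"
    by (intro integrable_mult_right integrable_of_real poisson_integrable)
  show ?I unfolding eq
    by (intro Bochner_Integration.integrable_add nevanlinna_integrable g i)
  have "(LINT x|\<mu>. defic_elem z x - boundary_elem \<kappa> x) =
    nevanlinna z + (LINT x|\<mu>. ?c * complex_of_real (1 / (1 + x\<^sup>2)))"
    unfolding eq nevanlinna_def
    by (intro Bochner_Integration.integral_add nevanlinna_integrable g i)
  also have "(LINT x|\<mu>. ?c * complex_of_real (1 / (1 + x\<^sup>2))) = ?c"
    using poisson_mass by (simp only: integral_mult_right_zero integral_complex_of_real of_real_1 mult_1_right)
  finally show ?E .
qed

lemma defic_elem_solve:
  assumes "complex_of_real x - z \<noteq> 0"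
  shows "w = defic_elem z x * v + a * defic_elem z x \<longleftrightarrow> v + z * w = complex_of_real x * w - a"
proof -
  have "w = defic_elem z x * v + a * defic_elem z x \<longleftrightarrow> w = (v + a) / (complex_of_real x - z)"
    by (simp add: defic_elem_def add_divide_distrib)
  also have "\<dots> \<longleftrightarrow> w * (complex_of_real x - z) = v + a"
    by (rule nonzero_eq_divide_eq[OF assms])
  finally show ?thesis by (auto simp: algebra_simps)
qed

text \<open>
  The solutions of \<open>(x - z) f - a = h\<close> form a one-parameter family; the boundary condition turns
  into a linear equation for \<open>a\<close>, whose leading coefficient is the denominator in the resolvent
  formula.
\<close>

lemma dissip_op_resolvent_iff:
  assumes inf: "emeasure \<mu> (space \<mu>) = \<infinity>" and \<kappa>: "\<kappa> \<noteq> 1" and g: "gap z"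
  shows "(h, f) \<in> resolvent \<mu> (dissip_op \<mu> \<kappa>) z \<longleftrightarrow> h \<in> L2 \<mu> \<and> f \<in> L2 \<mu> \<and>
    (\<exists>a. (AE x in \<mu>. f x = defic_elem z x * h x + a * defic_elem z x) \<and>
      l2_inner \<mu> h (defic_elem (cnj z)) + a * (nevanlinna z + \<i> * ((\<kappa> + 1) / (\<kappa> - 1))) = 0)"
proof -
  let ?D = "nevanlinna z + \<i> * ((\<kappa> + 1) / (\<kappa> - 1))"
  have int: "(LINT x|\<mu>. f x - a * boundary_elem \<kappa> x) = l2_inner \<mu> h (defic_elem (cnj z)) + a * ?D"
    if h: "h \<in> L2 \<mu>" and f: "f \<in> L2 \<mu>"
      and ae: "AE x in \<mu>. f x = defic_elem z x * h x + a * defic_elem z x" for h f a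
  proof -
    note I = integral_defic_minus_boundary_elem[OF g \<kappa>]
    have hz: "integrable \<mu> (\<lambda>x. h x * defic_elem z x)"
      by (intro L2_mult_integrable h defic_elem_L2 g)
    have "(LINT x|\<mu>. f x - a * boundary_elem \<kappa> x) =
      (LINT x|\<mu>. h x * defic_elem z x + a * (defic_elem z x - boundary_elem \<kappa> x))"
    proof (rule integral_cong_AE)
      show "AE x in \<mu>. f x - a * boundary_elem \<kappa> x =
          h x * defic_elem z x + a * (defic_elem z x - boundary_elem \<kappa> x)"
        using ae by eventually_elim (simp add: algebra_simps)
    qed (use f h boundary_elem_L2[of \<kappa>] in \<open>auto simp: L2_def\<close>)
    also have "\<dots> = (LINT x|\<mu>. h x * defic_elem z x) + a * ?D"
      using hz I by (subst Bochner_Integration.integral_add) auto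
    finally show ?thesis by (simp add: l2_inner_def defic_elem_cnj)
  qed
  show ?thesis
  proof
    assume "(h, f) \<in> resolvent \<mu> (dissip_op \<mu> \<kappa>) z"
    then obtain k where h: "h \<in> L2 \<mu>" and fk: "(f, k) \<in> dissip_op \<mu> \<kappa>"
      and ae: "AE x in \<mu>. h x = 1 * k x + - z * f x"
      by (auto simp: resolvent_def op_affine_def)
    obtain a where f: "f \<in> L2 \<mu>" and ka: "AE x in \<mu>. k x = complex_of_real x * f x - a"
      and i0: "(LINT x|\<mu>. f x - a * boundary_elem \<kappa> x) = 0"
      using fk by (auto simp: dissip_op_iff[OF inf \<kappa>])
    have "AE x in \<mu>. f x = defic_elem z x * h x + a * defic_elem z x"
      using ka ae gap_neq[OF g]
      by eventually_elim (simp add: defic_elem_solve)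
    then show "h \<in> L2 \<mu> \<and> f \<in> L2 \<mu> \<and>
      (\<exists>a. (AE x in \<mu>. f x = defic_elem z x * h x + a * defic_elem z x) \<and>
        l2_inner \<mu> h (defic_elem (cnj z)) + a * ?D = 0)"
      using h f i0 int[OF h f] by auto
  next
    assume "h \<in> L2 \<mu> \<and> f \<in> L2 \<mu> \<and>
      (\<exists>a. (AE x in \<mu>. f x = defic_elem z x * h x + a * defic_elem z x) \<and>
        l2_inner \<mu> h (defic_elem (cnj z)) + a * ?D = 0)"
    then obtain a where h: "h \<in> L2 \<mu>" and f: "f \<in> L2 \<mu>"
      and ae: "AE x in \<mu>. f x = defic_elem z x * h x + a * defic_elem z x"
      and eq: "l2_inner \<mu> h (defic_elem (cnj z)) + a * ?D = 0" by blast
    define k where "k = (\<lambda>x. h x + z * f x)"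
    have "k \<in> L2 \<mu>" unfolding k_def by (intro L2_add L2_scale h f)
    moreover have "AE x in \<mu>. k x = complex_of_real x * f x - a"
      using ae gap_neq[OF g]
      by eventually_elim (unfold k_def, erule defic_elem_solve[THEN iffD1, rotated])
    ultimately have "(f, k) \<in> dissip_op \<mu> \<kappa>"
      using f eq int[OF h f ae] by (auto simp: dissip_op_iff[OF inf \<kappa>])
    then show "(h, f) \<in> resolvent \<mu> (dissip_op \<mu> \<kappa>) z"
      using h by (auto simp: resolvent_def op_affine_def k_def intro!: exI[of _ k])
  qed
qed

lemma defic_elem_not_null:
  assumes inf: "emeasure \<mu> (space \<mu>) = \<infinity>" and g: "gap z"
  shows "\<not> (AE x in \<mu>. defic_elem z x = 0)"
proof
  assume "AE x in \<mu>. defic_elem z x = 0"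
  then have "AE x in \<mu>. False"
    using gap_neq[OF g] by eventually_elim (simp add: defic_elem_def)
  then have "emeasure \<mu> (space \<mu>) = 0" using emeasure_eq_0_AE[of "\<lambda>_. True" \<mu>] by simp
  then show False using inf by simp
qed

text \<open>
  If the coefficient of \<open>a\<close> vanished, both \<open>0\<close> and \<open>1 / (x - z)\<close> would solve the equation with
  right-hand side \<open>0\<close>.
\<close>

lemma dissip_op_denominator_nonzero:
  assumes inf: "emeasure \<mu> (space \<mu>) = \<infinity>" and \<kappa>: "\<kappa> \<noteq> 1" and g: "gap z"
    and z: "z \<in> resolvent_set \<mu> (dissip_op \<mu> \<kappa>)"
  shows "nevanlinna z + \<i> * ((\<kappa> + 1) / (\<kappa> - 1)) \<noteq> 0"
proof
  assume D: "nevanlinna z + \<i> * ((\<kappa> + 1) / (\<kappa> - 1)) = 0"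
  have z0: "(\<lambda>x. 0) \<in> L2 \<mu>" by (simp add: L2_def)
  have in1: "((\<lambda>x. 0), defic_elem z) \<in> resolvent \<mu> (dissip_op \<mu> \<kappa>) z"
    unfolding dissip_op_resolvent_iff[OF inf \<kappa> g]
    using D z0 defic_elem_L2[OF g] by (auto simp: l2_inner_def intro!: exI[of _ 1])
  have in0: "((\<lambda>x. 0), (\<lambda>x. 0)) \<in> resolvent \<mu> (dissip_op \<mu> \<kappa>) z"
    unfolding dissip_op_resolvent_iff[OF inf \<kappa> g]
    using z0 by (auto simp: l2_inner_def intro!: exI[of _ 0])
  have "AE x in \<mu>. defic_elem z x = 0"
    using z in1 in0 unfolding resolvent_set_def by blast
  then show False using defic_elem_not_null[OF inf g] by blast
qed

end

theorem theorem5p2: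
  fixes s :: "complex \<Rightarrow> complex" and \<kappa> :: complex and \<mu> :: "real measure"
    and g :: "real \<Rightarrow> complex" and z :: complex
  assumes kappa: "cmod \<kappa> < 1"
    and s_hol: "s holomorphic_on {z. Im z > 0}"
    and s_disk: "s ` {z. Im z > 0} \<subseteq> ball 0 1"
    and s_i: "s \<i> = 0"
    and s_lim: "\<And>\<alpha> \<epsilon>. \<alpha> \<in> {0..<pi} \<Longrightarrow> \<epsilon> > 0 \<Longrightarrow>
      filterlim (\<lambda>z. z * (s z - exp (2 * \<i> * complex_of_real \<alpha>))) at_infinity
        (inf at_infinity (principal {z. \<epsilon> \<le> Arg z \<and> Arg z \<le> pi - \<epsilon>}))"
    and mu_borel: "sets \<mu> = sets borel"
    and mu_inf: "emeasure \<mu> (space \<mu>) = \<infinity>"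
    and mu_norm: "(LINT x|\<mu>. 1 / (1 + x\<^sup>2)) = 1"
    and mu_repr: "\<And>z. Im z > 0 \<Longrightarrow> livsic_to_weyl s z =
      (LINT x|\<mu>. 1 / (complex_of_real x - z) - complex_of_real (x / (1 + x\<^sup>2)))"
    and g_def: "g \<in> deficiency_space \<mu> (sym_op \<mu>) \<i>"
    and g_norm: "l2_norm \<mu> g = 1"
    and z: "z \<in> resolvent_set \<mu> (dissip_op \<mu> \<kappa>) \<inter> resolvent_set \<mu> (mult_op \<mu>)"
  shows "weyl_titchmarsh \<mu> (mult_op \<mu>) g z + \<i> * ((\<kappa> + 1) / (\<kappa> - 1)) \<noteq> 0 \<and>
    defic_elem z \<in> deficiency_space \<mu> (sym_op \<mu>) z \<and>
    defic_elem (cnj z) \<in> deficiency_space \<mu> (sym_op \<mu>) (cnj z) \<and>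
    (let p = inverse (weyl_titchmarsh \<mu> (mult_op \<mu>) g z + \<i> * ((\<kappa> + 1) / (\<kappa> - 1))) in
       resolvent \<mu> (dissip_op \<mu> \<kappa>) z =
         {(h, f). f \<in> L2 \<mu> \<and>
            (\<exists>u. (h, u) \<in> resolvent \<mu> (mult_op \<mu>) z \<and>
               (AE x in \<mu>. f x =
                  u x - p * l2_inner \<mu> h (defic_elem (cnj z)) * defic_elem z x))})"
proof -
  have "integrable \<mu> (\<lambda>x. 1 / (1 + x\<^sup>2))"
    using mu_norm not_integrable_integral_eq by fastforce
  then interpret unit_poisson_measure \<mu>
    using mu_borel mu_norm by unfold_locales
  have \<kappa>: "\<kappa> \<noteq> 1" using kappa by auto
  have g: "gap z" using z gap_if_resolvent_set by blast
  have W: "weyl_titchmarsh \<mu> (mult_op \<mu>) g z = nevanlinna z"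
    by (rule weyl_titchmarsh_eq_nevanlinna[OF \<open>gap z\<close> g_def g_norm])
  define D where "D = nevanlinna z + \<i> * ((\<kappa> + 1) / (\<kappa> - 1))"
  have D: "D \<noteq> 0"
    unfolding D_def using z by (intro dissip_op_denominator_nonzero[OF mu_inf \<kappa> \<open>gap z\<close>]) blast
  have solve: "l + a * D = 0 \<longleftrightarrow> a = - (inverse D * l)" for l a :: complex
    using D by (auto simp: field_simps add_eq_0_iff)
  have R: "resolvent \<mu> (dissip_op \<mu> \<kappa>) z =
         {(h, f). f \<in> L2 \<mu> \<and>
            (\<exists>u. (h, u) \<in> resolvent \<mu> (mult_op \<mu>) z \<and>
               (AE x in \<mu>. f x =
                  u x - inverse D * l2_inner \<mu> h (defic_elem (cnj z)) * defic_elem z x))}" (is "_ = ?S")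
  proof (intro set_eqI, clarify)
    fix h f
    let ?l = "inverse D * l2_inner \<mu> h (defic_elem (cnj z))"
    have "(h, f) \<in> resolvent \<mu> (dissip_op \<mu> \<kappa>) z \<longleftrightarrow> h \<in> L2 \<mu> \<and> f \<in> L2 \<mu> \<and>
      (AE x in \<mu>. f x = defic_elem z x * h x - ?l * defic_elem z x)"
      unfolding dissip_op_resolvent_iff[OF mu_inf \<kappa> \<open>gap z\<close>] D_def[symmetric] solve by simp
    also have "\<dots> \<longleftrightarrow> (h, f) \<in> ?S"
    proof
      assume A: "h \<in> L2 \<mu> \<and> f \<in> L2 \<mu> \<and> (AE x in \<mu>. f x = defic_elem z x * h x - ?l * defic_elem z x)"
      then have "(h, \<lambda>x. defic_elem z x * h x) \<in> resolvent \<mu> (mult_op \<mu>) z"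
        unfolding mult_op_resolvent_iff[OF \<open>gap z\<close>] using L2_mult_defic_elem[OF \<open>gap z\<close>] by auto
      then show "(h, f) \<in> ?S" using A by auto
    next
      assume "(h, f) \<in> ?S"
      then obtain u where f: "f \<in> L2 \<mu>" and u: "(h, u) \<in> resolvent \<mu> (mult_op \<mu>) z"
        and ae: "AE x in \<mu>. f x = u x - ?l * defic_elem z x" by auto
      have "AE x in \<mu>. u x = defic_elem z x * h x"
        using u unfolding mult_op_resolvent_iff[OF \<open>gap z\<close>] by blast
      with ae have "AE x in \<mu>. f x = defic_elem z x * h x - ?l * defic_elem z x"
        by eventually_elim simp
      then show "h \<in> L2 \<mu> \<and> f \<in> L2 \<mu> \<and> (AE x in \<mu>. f x = defic_elem z x * h x - ?l * defic_elem z x)"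
        using f u unfolding mult_op_resolvent_iff[OF \<open>gap z\<close>] by blast
    qed
    finally show "(h, f) \<in> resolvent \<mu> (dissip_op \<mu> \<kappa>) z \<longleftrightarrow> (h, f) \<in> ?S" .
  qed
  show ?thesis
    unfolding W Let_def D_def[symmetric]
    using D R defic_elem_in_deficiency_space[OF \<open>gap z\<close>]
      defic_elem_in_deficiency_space[OF gap_cnj[OF \<open>gap z\<close>]] by blast
qed

end
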